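(* The following hold. (i) For all nano topological spaces $(\mathcal{U},\tau_{\mathcal{R}}(\mathcal{M}))$ and $(\mathcal{V},\sigma_{\mathcal{R}}(\mathcal{N}))$, every N-continuous map $h:\mathcal{U}\to\mathcal{V}$ is N$\alpha$-continuous, and hence also NS$\alpha$-continuous. The converses fail in general: there exist nano topological spaces and a map between them that is N$\alpha$-continuous but not N-continuous, and there exist nano topological spaces and a map between them that is NS$\alpha$-continuous but not N-continuous. (ii) For all nano topological spaces $(\mathcal{U},\tau_{\mathcal{R}}(\mathcal{M}))$ and $(\mathcal{V},\sigma_{\mathcal{R}}(\mathcal{N}))$, every N$\alpha$-continuous map $h:\mathcal{U}\to\mathcal{V}$ is NS$\alpha$-continuous. The converse fails in general: there exist nano topological spaces and a map between them that is NS$\alpha$-continuous but not N$\alpha$-continuous.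
   Context: Nano topological space: let $\mathcal{U}$ be a non-empty finite set (the universe), $\mathcal{R}$ an equivalence relation on $\mathcal{U}$ and $\mathcal{M}\subseteq\mathcal{U}$. The lower approximation $L$ of $\mathcal{M}$ is the union of the $\mathcal{R}$-classes contained in $\mathcal{M}$, the upper approximation $H$ is the union of the $\mathcal{R}$-classes meeting $\mathcal{M}$, and $B=H\setminus L$ is the boundary. Then $\tau_{\mathcal{R}}(\mathcal{M})=\{\emptyset,\mathcal{U},L,H,B\}$ is a topology on $\mathcal{U}$, and $(\mathcal{U},\tau_{\mathcal{R}}(\mathcal{M}))$ is called a nano topological space. Each space has its own equivalence relation; the symbol $\mathcal{R}$ is used for all of them. Members of $\tau_{\mathcal{R}}(\mathcal{M})$ are called N-open and their complements N-closed; $\mathrm{Nint}$ and $\mathrm{Ncl}$ denote interior and closure in this topology. A subset $\mathcal{D}\subseteq\mathcal{U}$ is N$\alpha$-open if $\mathcal{D}\subseteq\mathrm{Nint}(\mathrm{Ncl}(\mathrm{Nint}(\mathcal{D})))$. It is NS$\alpha$-open if there is an N$\alpha$-open set $\mathcal{P}$ with $\mathcal{P}\subseteq\mathcal{D}\subseteq\mathrm{Ncl}(\mathcal{P})$; equivalently, $\mathcal{D}\subseteq\mathrm{Ncl}(\mathrm{Nint}(\mathrm{Ncl}(\mathrm{Nint}(\mathcal{D}))))$. A map $h:\mathcal{U}\to\mathcal{V}$ between nano topological spaces is N-continuous (respectively N$\alpha$-continuous, NS$\alpha$-continuous) if for every N-open set $\mathcal{D}$ in $\mathcal{V}$, the set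 $h^{-1}(\mathcal{D})$ is N-open (respectively N$\alpha$-open, NS$\alpha$-open) in $\mathcal{U}$. *)

theory Defs
  imports "HOL-Analysis.Abstract_Topology"
begin

definition lower_approx :: "'a set \<Rightarrow> 'a rel \<Rightarrow> 'a set \<Rightarrow> 'a set" where
  "lower_approx U R M = \<Union>{C \<in> U // R. C \<subseteq> M}"

definition upper_approx :: "'a set \<Rightarrow> 'a rel \<Rightarrow> 'a set \<Rightarrow> 'a set" where
  "upper_approx U R M = \<Union>{C \<in> U // R. C \<inter> M \<noteq> {}}"

definition boundary_region :: "'a set \<Rightarrow> 'a rel \<Rightarrow> 'a set \<Rightarrow> 'a set" where
  "boundary_region U R M = upper_approx U R M - lower_approx U R M"

definition nano_opens :: "'a set \<Rightarrow> 'a rel \<Rightarrow> 'a set \<Rightarrow> 'a set set" where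
  "nano_opens U R M =
     {{}, U, lower_approx U R M, upper_approx U R M, boundary_region U R M}"

definition nano_space :: "'a set \<Rightarrow> 'a rel \<Rightarrow> 'a set \<Rightarrow> bool" where
  "nano_space U R M \<longleftrightarrow> finite U \<and> U \<noteq> {} \<and> equiv U R \<and> M \<subseteq> U"

text \<open>
  Meaningful only under \<open>nano_space U R M\<close>; the lemmas \<open>openin_nano_topology\<close> and
  \<open>topspace_nano_topology\<close> below then identify its open sets and its underlying set.
\<close>

definition nano_topology :: "'a set \<Rightarrow> 'a rel \<Rightarrow> 'a set \<Rightarrow> 'a topology" where
  "nano_topology U R M = topology (\<lambda>S. S \<in> nano_opens U R M)"

lemma upper_approx_subset:
  assumes "nano_space U R M"
  shows "upper_approx U R M \<subseteq> U"
proof -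
  have "C \<subseteq> U" if "C \<in> U // R" for C
    using that assms in_quotient_imp_subset unfolding nano_space_def by metis
  then show ?thesis unfolding upper_approx_def by blast
qed

lemma lower_approx_subset_upper_approx:
  assumes "nano_space U R M"
  shows "lower_approx U R M \<subseteq> upper_approx U R M"
proof -
  have "C \<inter> M \<noteq> {}" if "C \<in> U // R" "C \<subseteq> M" for C
    using that assms in_quotient_imp_non_empty[of U R C] unfolding nano_space_def by blast
  then show ?thesis
    unfolding lower_approx_def upper_approx_def by blast
qed

lemma istopology_finite_family:
  assumes fin: "finite T" and emp: "{} \<in> T"
    and int: "\<And>A B. A \<in> T \<Longrightarrow> B \<in> T \<Longrightarrow> A \<inter> B \<in> T"
    and un: "\<And>A B. A \<in> T \<Longrightarrow> B \<in> T \<Longrightarrow> A \<union> B \<in> T"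
  shows "istopology (\<lambda>A. A \<in> T)"
proof -
  have "\<Union>K \<in> T" if K: "\<forall>A\<in>K. A \<in> T" for K
  proof -
    have "finite K" using K fin finite_subset[of K T] by blast
    then show ?thesis using K
      by (induction K) (simp_all add: emp un)
  qed
  then show ?thesis unfolding istopology_def using int by blast
qed

lemma istopology_nano_opens:
  assumes "nano_space U R M"
  shows "istopology (\<lambda>S. S \<in> nano_opens U R M)"
proof -
  let ?L = "lower_approx U R M" and ?H = "upper_approx U R M"
  let ?T = "{{}, U, ?L, ?H, ?H - ?L}"
  have sub: "?L \<subseteq> ?H" "?H \<subseteq> U"
    using lower_approx_subset_upper_approx upper_approx_subset assms by blast+
  have int: "S \<inter> T \<in> ?T" if "S \<in> ?T" "T \<in> ?T" for S T
  proof -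
    have "?L \<inter> (?H - ?L) = {}" "(?H - ?L) \<inter> ?L = {}" "?L \<inter> ?H = ?L" "?H \<inter> ?L = ?L"
      "?H \<inter> (?H - ?L) = ?H - ?L" "(?H - ?L) \<inter> ?H = ?H - ?L"
      "U \<inter> ?L = ?L" "?L \<inter> U = ?L" "U \<inter> ?H = ?H" "?H \<inter> U = ?H"
      "U \<inter> (?H - ?L) = ?H - ?L" "(?H - ?L) \<inter> U = ?H - ?L"
      using sub by blast+
    then show ?thesis using that by (elim insertE emptyE; hypsubst; simp only: insert_iff Int_empty_left Int_empty_right Int_absorb simp_thms)
  qed
  have un: "S \<union> T \<in> ?T" if "S \<in> ?T" "T \<in> ?T" for S T
  proof -
    have "?L \<union> (?H - ?L) = ?H" "(?H - ?L) \<union> ?L = ?H" "?L \<union> ?H = ?H" "?H \<union> ?L = ?H"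
      "?H \<union> (?H - ?L) = ?H" "(?H - ?L) \<union> ?H = ?H"
      "U \<union> ?L = U" "?L \<union> U = U" "U \<union> ?H = U" "?H \<union> U = U"
      "U \<union> (?H - ?L) = U" "(?H - ?L) \<union> U = U"
      using sub by blast+
    then show ?thesis using that by (elim insertE emptyE; hypsubst; simp only: insert_iff Un_empty_left Un_empty_right Un_absorb simp_thms)
  qed
  show ?thesis
    unfolding nano_opens_def boundary_region_def
    by (rule istopology_finite_family[OF _ _ int un]) simp_all
qed

lemma openin_nano_topology:
  assumes "nano_space U R M"
  shows "openin (nano_topology U R M) S \<longleftrightarrow> S \<in> nano_opens U R M"
  unfolding nano_topology_def
  by (simp add: topology_inverse'[OF istopology_nano_opens[OF assms]])

lemma topspace_nano_topology:
  assumes "nano_space U R M"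
  shows "topspace (nano_topology U R M) = U"
proof -
  have "\<Union>(nano_opens U R M) = U"
    using upper_approx_subset[OF assms] lower_approx_subset_upper_approx[OF assms]
    unfolding nano_opens_def boundary_region_def by blast
  moreover have "{S. openin (nano_topology U R M) S} = nano_opens U R M"
    using openin_nano_topology[OF assms] by blast
  ultimately show ?thesis
    unfolding topspace_def by (simp only:)
qed

definition alpha_openin :: "'a topology \<Rightarrow> 'a set \<Rightarrow> bool" where
  "alpha_openin X D \<longleftrightarrow>
     D \<subseteq> topspace X \<and> D \<subseteq> X interior_of (X closure_of (X interior_of D))"

definition semi_alpha_openin :: "'a topology \<Rightarrow> 'a set \<Rightarrow> bool" where
  "semi_alpha_openin X D \<longleftrightarrow>
     D \<subseteq> topspace X \<and> (\<exists>P. alpha_openin X P \<and> P \<subseteq> D \<and> D \<subseteq> X closure_of P)"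

text \<open>As in \<open>continuous_map\<close>, preimages are taken inside the underlying set of the domain.\<close>

definition alpha_continuous_map :: "'a topology \<Rightarrow> 'b topology \<Rightarrow> ('a \<Rightarrow> 'b) \<Rightarrow> bool" where
  "alpha_continuous_map X Y h \<longleftrightarrow>
     h \<in> topspace X \<rightarrow> topspace Y \<and>
     (\<forall>D. openin Y D \<longrightarrow> alpha_openin X {x \<in> topspace X. h x \<in> D})"

definition semi_alpha_continuous_map :: "'a topology \<Rightarrow> 'b topology \<Rightarrow> ('a \<Rightarrow> 'b) \<Rightarrow> bool" where
  "semi_alpha_continuous_map X Y h \<longleftrightarrow>
     h \<in> topspace X \<rightarrow> topspace Y \<and>
     (\<forall>D. openin Y D \<longrightarrow> semi_alpha_openin X {x \<in> topspace X. h x \<in> D})"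

end

theory Submission
  imports Defs
begin

text \<open>
  The positive part holds for arbitrary topological spaces: open implies \<open>\<alpha>\<close>-open implies
  semi-\<open>\<alpha>\<close>-open. For the counterexamples, maps into the nano space on \<open>{0, 1}\<close> with open sets
  \<open>{}\<close>, \<open>{0}\<close>, \<open>{0, 1}\<close> are classified by the preimage \<open>A\<close> of the point \<open>0\<close>, so one only needs
  subsets \<open>A\<close> of nano spaces separating the three notions. A non-open set whose interior is
  dense is \<open>\<alpha>\<close>-open; a closed non-open set is never \<open>\<alpha>\<close>-open, but it is semi-\<open>\<alpha>\<close>-open as soon as
  it is the closure of an open set.
\<close>

text \<open>An open \<open>D\<close> is its own interior and lies in its closure, so by maximality
  of the interior it lies in the interior of that closure.\<close>

lemma openin_imp_alpha_openin:
  assumes "openin X D"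
  shows "alpha_openin X D"
  unfolding alpha_openin_def
  using assms by (metis closure_of_subset interior_of_maximal interior_of_openin openin_subset)

text \<open>The witness \<open>P\<close> is \<open>D\<close> itself.\<close>

lemma alpha_openin_imp_semi_alpha_openin:
  assumes "alpha_openin X D"
  shows "semi_alpha_openin X D"
  using assms unfolding semi_alpha_openin_def alpha_openin_def
  by (meson closure_of_subset order_refl)

lemma continuous_imp_alpha_continuous_map:
  assumes "continuous_map X Y h"
  shows "alpha_continuous_map X Y h"
  using assms unfolding continuous_map_def alpha_continuous_map_def
  by (simp add: openin_imp_alpha_openin)

lemma alpha_imp_semi_alpha_continuous_map:
  assumes "alpha_continuous_map X Y h"
  shows "semi_alpha_continuous_map X Y h"
  using assms unfolding alpha_continuous_map_def semi_alpha_continuous_map_def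
  by (simp add: alpha_openin_imp_semi_alpha_openin)

text \<open>The interior of \<open>D\<close> contains \<open>P\<close> and is therefore dense; its
  closure is the whole space, which is open.\<close>

lemma alpha_openin_superset_dense_open:
  assumes "openin X P" "P \<subseteq> D" "D \<subseteq> topspace X" "X closure_of P = topspace X"
  shows "alpha_openin X D"
proof -
  have "X closure_of P \<subseteq> X closure_of (X interior_of D)"
    using assms by (intro closure_of_mono interior_of_maximal)
  then have "X closure_of (X interior_of D) = topspace X"
    using assms(4) closure_of_subset_topspace by (metis subset_antisym)
  then show ?thesis
    using assms(3) by (simp add: alpha_openin_def)
qed

text \<open>Closing the interior of a closed set does not leave that set, so the condition for
  \<open>alpha_openin\<close> collapses to \<open>D\<close> lying in its own interior.\<close>

lemma closedin_alpha_openin_imp_openin: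
  assumes "closedin X D" "alpha_openin X D"
  shows "openin X D"
proof -
  have "X closure_of (X interior_of D) \<subseteq> D"
    using assms(1) by (simp add: closure_of_minimal interior_of_subset)
  then have "D \<subseteq> X interior_of D"
    using assms(2) interior_of_mono unfolding alpha_openin_def by blast
  then show ?thesis
    by (simp add: subset_interior_of_eq)
qed

lemma nano_space_Id_on:
  assumes "finite U" "U \<noteq> {}" "M \<subseteq> U"
  shows "nano_space U (Id_on U) M"
  using assms unfolding nano_space_def equiv_def
  by (auto simp: refl_on_def sym_def trans_def)

text \<open>The classes of \<open>Id_on U\<close> are singletons, so both approximations return
  \<open>M\<close> and the boundary is empty.\<close>

lemma nano_opens_Id_on:
  assumes "M \<subseteq> U"
  shows "nano_opens U (Id_on U) M = {{}, U, M}"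
proof -
  have "U // Id_on U = (\<lambda>x. {x}) ` U"
    by (auto simp: quotient_def)
  then have "lower_approx U (Id_on U) M = M" "upper_approx U (Id_on U) M = M"
    using assms by (auto simp: lower_approx_def upper_approx_def)
  then show ?thesis
    by (auto simp: nano_opens_def boundary_region_def)
qed

abbreviation two_point_space :: "nat topology" where
  "two_point_space \<equiv> nano_topology {0, 1} (Id_on {0, 1}) {0}"

lemma nano_space_two_point: "nano_space {0, 1::nat} (Id_on {0, 1}) {0}"
  by (rule nano_space_Id_on) auto

lemma openin_two_point_space:
  "openin two_point_space D \<longleftrightarrow> D \<in> {{}, {0, 1}, {0}}"
  unfolding openin_nano_topology[OF nano_space_two_point]
  by (subst nano_opens_Id_on) auto

text \<open>The predicate \<open>P\<close> is kept abstract so that one argument serves all three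
  kinds of continuity; the trivial open sets of the codomain only contribute \<open>P {}\<close> and
  \<open>P (topspace X)\<close>.\<close>

lemma preimages_two_point_space:
  assumes "A \<subseteq> topspace X" "P {}" "P (topspace X)"
  shows "(\<forall>D. openin two_point_space D \<longrightarrow>
            P {x \<in> topspace X. (if x \<in> A then 0 else 1) \<in> D}) \<longleftrightarrow> P A"
proof -
  have "{x \<in> topspace X. (if x \<in> A then 0 else 1) \<in> {0::nat}} = A"
    "{x \<in> topspace X. (if x \<in> A then 0 else 1) \<in> {0, 1::nat}} = topspace X"
    using assms(1) by auto
  then show ?thesis
    unfolding openin_two_point_space
    using assms(2,3) by simp
qed

lemma maps_two_point_space:
  "(\<lambda>x. if x \<in> A then 0 else 1) \<in> topspace X \<rightarrow> topspace two_point_space"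
  unfolding topspace_nano_topology[OF nano_space_two_point] by auto

lemma continuous_map_two_point_space:
  assumes "A \<subseteq> topspace X"
  shows "continuous_map X two_point_space (\<lambda>x. if x \<in> A then 0 else 1) \<longleftrightarrow> openin X A"
  using preimages_two_point_space[where P = "openin X", OF assms] maps_two_point_space[of A X]
  by (simp add: continuous_map_def)

lemma alpha_continuous_map_two_point_space:
  assumes "A \<subseteq> topspace X"
  shows "alpha_continuous_map X two_point_space (\<lambda>x. if x \<in> A then 0 else 1) \<longleftrightarrow>
    alpha_openin X A"
  using preimages_two_point_space[where P = "alpha_openin X", OF assms] maps_two_point_space[of A X]
  by (simp add: alpha_continuous_map_def openin_imp_alpha_openin)

lemma semi_alpha_continuous_map_two_point_space:
  assumes "A \<subseteq> topspace X"
  shows "semi_alpha_continuous_map X two_point_space (\<lambda>x. if x \<in> A then 0 else 1) \<longleftrightarrow>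
    semi_alpha_openin X A"
  using preimages_two_point_space[where P = "semi_alpha_openin X", OF assms] maps_two_point_space[of A X]
  by (simp add: semi_alpha_continuous_map_def openin_imp_alpha_openin
      alpha_openin_imp_semi_alpha_openin)

text \<open>Every nonempty open set contains \<open>0\<close>, so \<open>{0}\<close> is dense and
  any superset of it is \<alpha>-open.\<close>

lemma alpha_openin_not_openin_example:
  defines "X \<equiv> nano_topology {0, 1, 2::nat} (Id_on {0, 1, 2}) {0}"
  shows "nano_space {0, 1, 2::nat} (Id_on {0, 1, 2}) {0}"
    and "{0, 1} \<subseteq> topspace X" "alpha_openin X {0, 1}" "\<not> openin X {0, 1}"
proof -
  show nano: "nano_space {0, 1, 2::nat} (Id_on {0, 1, 2}) {0}"
    by (rule nano_space_Id_on) auto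
  have top: "topspace X = {0, 1, 2}"
    unfolding X_def by (rule topspace_nano_topology[OF nano])
  have opn: "openin X S \<longleftrightarrow> S \<in> {{}, {0, 1, 2}, {0}}" for S
    unfolding X_def openin_nano_topology[OF nano] by (subst nano_opens_Id_on) auto
  have "X closure_of {0} = topspace X"
    by (auto simp: closure_of_def opn top)
  then show "alpha_openin X {0, 1}"
    by (intro alpha_openin_superset_dense_open[of X "{0}"]) (auto simp: opn top)
  show "{0, 1} \<subseteq> topspace X"
    by (simp add: top)
  \<comment> \<open>The whole space is the only open set containing \<open>1\<close>.\<close>
  have "2 \<in> S" if "openin X S" "1 \<in> S" for S
    using that unfolding opn by fastforce
  then show "\<not> openin X {0, 1}"
    by fastforce
qed

text \<open>The set \<open>{0, 1}\<close> splits the class \<open>{1, 2}\<close>, which becomes the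
  boundary, and misses the class of \<open>3\<close>, whose only open neighbourhood is the whole
  space. Thus \<open>{0, 3}\<close> is the complement of the boundary and the closure of the open
  set \<open>{0}\<close>.\<close>

lemma semi_alpha_openin_not_alpha_openin_example:
  fixes U :: "nat set" and R :: "nat rel"
  defines "U \<equiv> {0, 1, 2, 3}"
    and "R \<equiv> {0} \<times> {0} \<union> {1, 2} \<times> {1, 2} \<union> {3} \<times> {3}"
  defines "X \<equiv> nano_topology U R {0, 1}"
  shows "nano_space U R {0, 1}"
    and "{0, 3} \<subseteq> topspace X" "semi_alpha_openin X {0, 3}" "\<not> alpha_openin X {0, 3}"
proof -
  have "equiv U R"
    by (rule equivI) (auto simp: U_def R_def refl_on_def sym_def trans_def)
  then show nano: "nano_space U R {0, 1}"
    by (auto simp: nano_space_def U_def)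
  have "topspace X = U"
    unfolding X_def by (rule topspace_nano_topology[OF nano])
  then have top: "topspace X = {0, 1, 2, 3}"
    by (simp add: U_def)
  have "R `` {0} = {0}" "R `` {1} = {1, 2}" "R `` {2} = {1, 2}" "R `` {3} = {3}"
    by (auto simp: R_def)
  then have quot: "U // R = {{0}, {1, 2}, {3}}"
    by (simp add: quotient_def U_def insert_commute)
  \<comment> \<open>Lets the simplifier filter the explicit list of classes one class at a
    time.\<close>
  have restrict_insert: "{x \<in> insert a A. P x} =
      (if P a then insert a {x \<in> A. P x} else {x \<in> A. P x})"
    for a :: "nat set" and A P
    by auto
  have "{C \<in> U // R. C \<subseteq> {0, 1}} = {{0}}"
    unfolding quot restrict_insert by simp
  then have L: "lower_approx U R {0, 1} = {0}"
    by (simp add: lower_approx_def)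
  have "{C \<in> U // R. C \<inter> {0, 1} \<noteq> {}} = {{0}, {1, 2}}"
    unfolding quot restrict_insert by simp
  then have H: "upper_approx U R {0, 1} = {0, 1, 2}"
    by (simp add: upper_approx_def insert_commute)
  have opn: "openin X S \<longleftrightarrow> S \<in> {{}, {0, 1, 2, 3}, {0}, {0, 1, 2}, {1, 2}}" for S
  proof -
    have "{0, 1, 2} - {0} = {1, 2::nat}" by auto
    then show ?thesis
      unfolding X_def openin_nano_topology[OF nano] nano_opens_def boundary_region_def L H
      by (simp add: U_def)
  qed
  have "{0, 3} \<subseteq> X closure_of {0}"
    by (auto simp: closure_of_def opn top)
  moreover have "alpha_openin X {0}"
    by (simp add: opn openin_imp_alpha_openin)
  ultimately show "semi_alpha_openin X {0, 3}"
    unfolding semi_alpha_openin_def top by blast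
  have "{0, 1, 2, 3} - {0, 3} = {1, 2::nat}" by auto
  then have "closedin X {0, 3}"
    by (simp add: closedin_def top opn)
  moreover have "1 \<in> S" if "openin X S" "3 \<in> S" for S
    using that unfolding opn by fastforce
  then have "\<not> openin X {0, 3}"
    by fastforce
  ultimately show "\<not> alpha_openin X {0, 3}"
    using closedin_alpha_openin_imp_openin by blast
  show "{0, 3} \<subseteq> topspace X"
    by (simp add: top)
qed

theorem proposition3p4:
  shows
    "((\<forall>(U :: 'a set) R M (V :: 'b set) S N h.
         nano_space U R M \<longrightarrow> nano_space V S N \<longrightarrow>
         continuous_map (nano_topology U R M) (nano_topology V S N) h \<longrightarrow>
           alpha_continuous_map (nano_topology U R M) (nano_topology V S N) h \<and>
           semi_alpha_continuous_map (nano_topology U R M) (nano_topology V S N) h) \<and>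
      (\<exists>(U :: nat set) R M (V :: nat set) S N h.
         nano_space U R M \<and> nano_space V S N \<and>
         alpha_continuous_map (nano_topology U R M) (nano_topology V S N) h \<and>
         \<not> continuous_map (nano_topology U R M) (nano_topology V S N) h) \<and>
      (\<exists>(U :: nat set) R M (V :: nat set) S N h.
         nano_space U R M \<and> nano_space V S N \<and>
         semi_alpha_continuous_map (nano_topology U R M) (nano_topology V S N) h \<and>
         \<not> continuous_map (nano_topology U R M) (nano_topology V S N) h)) \<and>
     ((\<forall>(U :: 'a set) R M (V :: 'b set) S N h.
         nano_space U R M \<longrightarrow> nano_space V S N \<longrightarrow>
         alpha_continuous_map (nano_topology U R M) (nano_topology V S N) h \<longrightarrow>
           semi_alpha_continuous_map (nano_topology U R M) (nano_topology V S N) h) \<and>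
      (\<exists>(U :: nat set) R M (V :: nat set) S N h.
         nano_space U R M \<and> nano_space V S N \<and>
         semi_alpha_continuous_map (nano_topology U R M) (nano_topology V S N) h \<and>
         \<not> alpha_continuous_map (nano_topology U R M) (nano_topology V S N) h))"
proof -
  note ex1 = alpha_openin_not_openin_example
  note ex2 = semi_alpha_openin_not_alpha_openin_example
  have alpha_not_cont: "\<exists>(U :: nat set) R M (V :: nat set) S N h.
      nano_space U R M \<and> nano_space V S N \<and>
      alpha_continuous_map (nano_topology U R M) (nano_topology V S N) h \<and>
      \<not> continuous_map (nano_topology U R M) (nano_topology V S N) h"
    \<comment> \<open>The existential witnesses stay schematic; unification with the example, the
      two-point space and the classification of maps fills them in.\<close>
    by (intro exI conjI, rule ex1(1), rule nano_space_two_point,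
        rule iffD2[OF alpha_continuous_map_two_point_space[OF ex1(2)] ex1(3)])
      (simp only: continuous_map_two_point_space[OF ex1(2)] ex1(4) not_False_eq_True)
  have semi_not_alpha: "\<exists>(U :: nat set) R M (V :: nat set) S N h.
      nano_space U R M \<and> nano_space V S N \<and>
      semi_alpha_continuous_map (nano_topology U R M) (nano_topology V S N) h \<and>
      \<not> alpha_continuous_map (nano_topology U R M) (nano_topology V S N) h"
    by (intro exI conjI, rule ex2(1), rule nano_space_two_point,
        rule iffD2[OF semi_alpha_continuous_map_two_point_space[OF ex2(2)] ex2(3)])
      (simp only: alpha_continuous_map_two_point_space[OF ex2(2)] ex2(4) not_False_eq_True)
  have semi_not_cont: "\<exists>(U :: nat set) R M (V :: nat set) S N h.
      nano_space U R M \<and> nano_space V S N \<and>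
      semi_alpha_continuous_map (nano_topology U R M) (nano_topology V S N) h \<and>
      \<not> continuous_map (nano_topology U R M) (nano_topology V S N) h"
    \<comment> \<open>The same map works: were it continuous, it would be
      \<alpha>-continuous.\<close>
    using semi_not_alpha continuous_imp_alpha_continuous_map by blast
  show ?thesis
    by (intro conjI alpha_not_cont semi_not_alpha semi_not_cont)
      (simp_all add: continuous_imp_alpha_continuous_map alpha_imp_semi_alpha_continuous_map)
qed

end
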